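(* Every nice set $T\subseteq X$ is collinear to one and only one of the following subsets of $X$: (a) if $|T|=0$: $T=T_1:=\emptyset$; (b) if $|T|=1$: $T_2:=\{\{1,2\}\}$; (c) if $|T|=2$: $T_3:=\{\{1,2\},\{1,3\}\}$, $T_4:=\{\{1,2\},\{1,5\}\}$, $T_5:=\{\{1,2\},\{6,7\}\}$; (d) if $|T|=3$: $T_6:=\{\{1,2\},\{1,5\},\{2,5\}\}$, $T_7:=\{\{2,5\},\{3,6\},\{4,7\}\}$, $T_8:=\{\{1,2\},\{1,3\},\{1,4\}\}$, $T_9:=\{\{1,2\},\{1,3\},\{1,5\}\}$, $T_{10}:=\{\{1,2\},\{1,3\},\{1,7\}\}$, $T_{11}:=\{\{1,2\},\{1,6\},\{2,6\}\}$, $T_{12}:=\{\{1,2\},\{1,6\},\{6,7\}\}$; (e) if $|T|=4$: $T_{13}:=\{\{1,2\},\{1,3\},\{1,4\},\{1,5\}\}$, $T_{14}:=\{\{1,2\},\{1,3\},\{1,5\},\{1,6\}\}$, $T_{15}:=\{\{1,2\},\{1,6\},\{1,7\},\{2,6\}\}$, $T_{16}:=\{\{1,2\},\{1,6\},\{2,7\},\{6,7\}\}$; (f) if $|T|=5$: $T_{17}:=\{\{1,2\},\{1,3\},\{1,4\},\{1,5\},\{1,6\}\}$, $T_{18}:=\{\{1,2\},\{1,6\},\{1,7\},\{2,6\},\{2,7\}\}$; (g) if $|T|=6$: $T_{19}:=\{\{3,4\},\{3,6\},\{3,7\},\{4,6\},\{4,7\},\{6,7\}\}$, $T_{20}:=\{\{1,j\}: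 2\le j\le 7\}$, $T_{21}:=P_{\{1,2,3\}}=\{\{1,2\},\{1,3\},\{1,7\},\{2,3\},\{2,6\},\{3,5\}\}$; (h) if $|T|=10$: $T_{22}:=P_{\{1,2,3\}}\cup P_{\{1,2,6\}}\cup P_{\{1,3,5\}}\cup P_{\{1,5,6\}}$; (i) if $|T|=15$: $T_{23}:=X\setminus T_{19}$; (j) if $|T|=21$: $T_{24}:=X$. In particular nice sets only occur with these cardinalities.
   Context: Let $I=\{1,\dots,7\}$ and write the elements of $\mathbb{Z}_2^3$ as $g_0=(0,0,0)$, $g_1=(1,0,0)$, $g_2=(0,1,0)$, $g_3=(0,0,1)$, $g_4=(1,1,1)$, $g_5=(1,1,0)$, $g_6=(1,0,1)$, $g_7=(0,1,1)$. For $i\ne j$ in $I$, $i\ast j\in I$ is the index with $g_{i\ast j}=g_i+g_j$; the lines $\{i,j,i\ast j\}$ of the Fano plane are $\{1,2,5\},\{5,6,7\},\{1,4,7\},\{1,3,6\},\{2,4,6\},\{2,3,7\},\{3,4,5\}$. Pairwise distinct $i,j,k\in I$ are called generative if $k\ne i\ast j$. Let $X=\{\{i,j\}: i,j\in I,\ i\neq j\}$ (21 elements). For $i,j,k$ generative, $P_{\{i,j,k\}}:=\{\{i,j\},\{j,k\},\{k,i\},\{i,j\ast k\},\{j,k\ast i\},\{k,i\ast j\}\}$. A subset $T\subseteq X$ is called nice if for all generative $i,j,k\in I$, $\{i,j\}\in T$ and $\{i\ast j,k\}\in T$ imply $P_{\{i,j,k\}}\subseteq T$. A collineation is a bijection $\sigma:I\to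 I$ with $\sigma(i\ast j)=\sigma(i)\ast\sigma(j)$ for all $i\ne j$. It acts on subsets of $X$ through $\tilde\sigma(\{i,j\})=\{\sigma(i),\sigma(j)\}$. Two subsets $T,T'\subseteq X$ are collinear if $\tilde\sigma(T)=T'$ for some collineation $\sigma$. *)

theory Defs
  imports Complex_Main "HOL-Library.Z2" "HOL-Library.Product_Plus"
begin

definition idx :: "nat set" where
  "idx = {1..7}"

text \<open>The elements $g_0, \dots, g_7$ of $\mathbb{Z}_2^3$; only the indices 0 to 7 are meaningful.\<close>

definition gvec :: "nat \<Rightarrow> bit \<times> bit \<times> bit" where
  "gvec i =
    [(0,0,0), (1,0,0), (0,1,0), (0,0,1), (1,1,1), (1,1,0), (1,0,1), (0,1,1)] ! i"

text \<open>Meaningful for distinct \<open>i, j \<in> idx\<close> only.\<close>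

definition star :: "nat \<Rightarrow> nat \<Rightarrow> nat"  (infixl \<open>\<ast>\<close> 70) where
  "i \<ast> j = (THE k. k \<in> idx \<and> gvec k = gvec i + gvec j)"

definition generative :: "nat \<Rightarrow> nat \<Rightarrow> nat \<Rightarrow> bool" where
  "generative i j k \<longleftrightarrow>
     i \<in> idx \<and> j \<in> idx \<and> k \<in> idx \<and> i \<noteq> j \<and> j \<noteq> k \<and> i \<noteq> k \<and> k \<noteq> i \<ast> j"

definition edges :: "nat set set" where
  "edges = {{i, j} | i j. i \<in> idx \<and> j \<in> idx \<and> i \<noteq> j}"

definition P :: "nat \<Rightarrow> nat \<Rightarrow> nat \<Rightarrow> nat set set" where
  "P i j k = {{i, j}, {j, k}, {k, i}, {i, j \<ast> k}, {j, k \<ast> i}, {k, i \<ast> j}}"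

definition nice :: "nat set set \<Rightarrow> bool" where
  "nice T \<longleftrightarrow> T \<subseteq> edges \<and>
     (\<forall>i j k. generative i j k \<longrightarrow> {i, j} \<in> T \<longrightarrow> {i \<ast> j, k} \<in> T \<longrightarrow> P i j k \<subseteq> T)"

text \<open>A bijection of \<open>idx\<close> is represented by any function on the naturals extending it.\<close>

definition collineation :: "(nat \<Rightarrow> nat) \<Rightarrow> bool" where
  "collineation \<sigma> \<longleftrightarrow> bij_betw \<sigma> idx idx \<and>
     (\<forall>i\<in>idx. \<forall>j\<in>idx. i \<noteq> j \<longrightarrow> \<sigma> (i \<ast> j) = \<sigma> i \<ast> \<sigma> j)"

definition collinear_sets :: "nat set set \<Rightarrow> nat set set \<Rightarrow> bool" where
  "collinear_sets T T' \<longleftrightarrow> (\<exists>\<sigma>. collineation \<sigma> \<and> (\<lambda>e. \<sigma> ` e) ` T = T')"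

definition T19 :: "nat set set" where
  "T19 = {{3,4}, {3,6}, {3,7}, {4,6}, {4,7}, {6,7}}"

text \<open>\<open>Trep n\<close> is the representative $T_n$, for \<open>1 \<le> n \<le> 24\<close>.\<close>

definition Trep :: "nat \<Rightarrow> nat set set" where
  "Trep n =
    [{},
     {{1,2}},
     {{1,2}, {1,3}},
     {{1,2}, {1,5}},
     {{1,2}, {6,7}},
     {{1,2}, {1,5}, {2,5}},
     {{2,5}, {3,6}, {4,7}},
     {{1,2}, {1,3}, {1,4}},
     {{1,2}, {1,3}, {1,5}},
     {{1,2}, {1,3}, {1,7}},
     {{1,2}, {1,6}, {2,6}},
     {{1,2}, {1,6}, {6,7}},
     {{1,2}, {1,3}, {1,4}, {1,5}},
     {{1,2}, {1,3}, {1,5}, {1,6}},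
     {{1,2}, {1,6}, {1,7}, {2,6}},
     {{1,2}, {1,6}, {2,7}, {6,7}},
     {{1,2}, {1,3}, {1,4}, {1,5}, {1,6}},
     {{1,2}, {1,6}, {1,7}, {2,6}, {2,7}},
     T19,
     {{1, j} | j. 2 \<le> j \<and> j \<le> 7},
     P 1 2 3,
     P 1 2 3 \<union> P 1 2 6 \<union> P 1 3 5 \<union> P 1 5 6,
     edges - T19,
     edges] ! (n - 1)"

lemma idx_eq: "idx = {1, 2, 3, 4, 5, 6, 7}"
  by (auto simp: idx_def)

lemma starI:
  assumes "k \<in> idx" "gvec k = gvec i + gvec j"
  shows "i \<ast> j = k"
proof -
  have "inj_on gvec idx"
    by (simp add: idx_eq gvec_def)
  then show ?thesis
    unfolding star_def using assms by (intro the_equality) (auto intro: inj_onD)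
qed

lemma P_123: "P 1 2 3 = {{1,2}, {1,3}, {1,7}, {2,3}, {2,6}, {3,5}}"
proof -
  have "2 \<ast> 3 = 7" "3 \<ast> 1 = 6" "1 \<ast> 2 = 5"
    by (rule starI; simp add: idx_eq gvec_def)+
  then show ?thesis
    by (auto simp: P_def insert_commute)
qed

end

theory Submission
  imports Defs
begin

text \<open>
  Call a collineation image of \<open>Trep n\<close> inside a nice set \<open>T\<close> a copy of \<open>Trep n\<close>, and take the largest
  \<open>n\<close> for which \<open>T\<close> has one. If the copy is not all of \<open>T\<close>, move it back to \<open>Trep n\<close> itself and pick an
  edge \<open>e\<close> of \<open>T\<close> outside \<open>Trep n\<close>. For each of the 386 pairs \<open>(n, e)\<close>, niceness forces enough further
  edges into \<open>T\<close> to give a copy of some \<open>Trep m\<close> with \<open>m > n\<close>, contradicting the choice of \<open>n\<close>.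
  Conversely no two representatives of equal cardinality are collinear. Both facts are finite
  computations, because a collineation is determined by the images of 1, 2, 3, and these may be any of
  the 168 ordered triples of points not on a line.
\<close>

section \<open>Points, lines and frames\<close>

text \<open>
  Everything that is evaluated in bulk branches through \<open>if\<close>: rewriting evaluates both operands
  of a conjunction or disjunction, but only the selected branch of a conditional.
\<close>

fun lazy_ex :: "('a \<Rightarrow> bool) \<Rightarrow> 'a list \<Rightarrow> bool" where
  "lazy_ex Q [] = False"
| "lazy_ex Q (x # xs) = (if Q x then True else lazy_ex Q xs)"

fun lazy_all :: "('a \<Rightarrow> bool) \<Rightarrow> 'a list \<Rightarrow> bool" where
  "lazy_all Q [] = True"
| "lazy_all Q (x # xs) = (if Q x then lazy_all Q xs else False)"

lemma lazy_ex_iff: "lazy_ex Q xs \<longleftrightarrow> (\<exists>x\<in>set xs. Q x)"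
  by (induction xs) auto

lemma lazy_all_iff: "lazy_all Q xs \<longleftrightarrow> (\<forall>x\<in>set xs. Q x)"
  by (induction xs) auto

datatype point = P1 | P2 | P3 | P4 | P5 | P6 | P7

definition points :: "point list" where
  "points = [P1, P2, P3, P4, P5, P6, P7]"

lemma set_points: "set points = UNIV"
  by (auto simp: points_def intro: point.exhaust)

text \<open>The values on the diagonal are junk.\<close>

fun third :: "point \<Rightarrow> point \<Rightarrow> point" where
  "third P1 = case_point P1 P5 P6 P7 P2 P3 P4"
| "third P2 = case_point P5 P2 P7 P6 P1 P4 P3"
| "third P3 = case_point P6 P7 P3 P5 P4 P1 P2"
| "third P4 = case_point P7 P6 P5 P4 P3 P2 P1"
| "third P5 = case_point P2 P1 P4 P3 P5 P7 P6"
| "third P6 = case_point P3 P4 P1 P2 P7 P6 P5"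
| "third P7 = case_point P4 P3 P2 P1 P6 P5 P7"

lemma third_commute: "third i j = third j i"
  by (cases i; cases j; simp)

lemma third_third: "i \<noteq> j \<Longrightarrow> third i (third i j) = j"
  by (cases i; cases j; simp)

text \<open>Three distinct points off a common line are three linearly independent vectors of
  \<open>Z_2^3\<close>. This is \<open>generative\<close> transported to the datatype of
  points.\<close>

definition independent :: "point \<Rightarrow> point \<Rightarrow> point \<Rightarrow> bool" where
  "independent a b c =
    (if a = b then False else if c = a then False else if c = b then False
     else c \<noteq> third a b)"

lemma independent_iff:
  "independent i j k \<longleftrightarrow> i \<noteq> j \<and> j \<noteq> k \<and> i \<noteq> k \<and> k \<noteq> third i j"
  by (auto simp: independent_def)

lemma independent_rotate: "independent i j k \<Longrightarrow> independent j k i"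
  unfolding independent_iff by (metis third_commute third_third)

text \<open>The linear map sending the basis \<open>P1\<close>, \<open>P2\<close>, \<open>P3\<close>
  to \<open>a\<close>, \<open>b\<close>, \<open>c\<close>. The other four values come from g_5 = g_1
  + g_2, g_6 = g_1 + g_3, g_7 = g_2 + g_3 and g_4 = g_5 + g_3.\<close>

definition frame :: "point \<Rightarrow> point \<Rightarrow> point \<Rightarrow> point \<Rightarrow> point" where
  "frame a b c =
    case_point a b c (third (third a b) c) (third a b) (third a c) (third b c)"

type_synonym pair = "point \<times> point"

definition pairs :: "pair list" where
  "pairs =
    [(P1,P2), (P1,P3), (P1,P4), (P1,P5), (P1,P6), (P1,P7), (P2,P3),
     (P2,P4), (P2,P5), (P2,P6), (P2,P7), (P3,P4), (P3,P5), (P3,P6),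
     (P3,P7), (P4,P5), (P4,P6), (P4,P7), (P5,P6), (P5,P7), (P6,P7)]"

lemma in_pairs: "i \<noteq> j \<Longrightarrow> (i, j) \<in> set pairs \<or> (j, i) \<in> set pairs"
  by (cases i; cases j; simp add: pairs_def)

lemma frame_third:
  assumes "independent a b c" "i \<noteq> j"
  shows "frame a b c (third i j) = third (frame a b c i) (frame a b c j)"
proof -
  \<comment> \<open>Checking one orientation of each pair is enough, since \<open>third\<close> is
    symmetric.\<close>
  have "\<forall>(i, j)\<in>set pairs. frame a b c (third i j) = third (frame a b c i) (frame a b c j)"
    using assms(1) by (cases a; cases b; cases c; simp add: independent_def frame_def pairs_def)
  then show ?thesis
    using in_pairs[OF assms(2)] by (auto simp: third_commute)
qed

lemma bij_frame:
  assumes "independent a b c"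
  shows "bij (frame a b c)"
proof -
  have "distinct (map (frame a b c) points)"
    using assms by (cases a; cases b; cases c; simp add: independent_def frame_def points_def)
  then have "inj (frame a b c)"
    by (simp add: distinct_map set_points)
  moreover have "finite (UNIV :: point set)"
    by (metis List.finite_set set_points)
  ultimately show ?thesis
    by (simp add: bij_def finite_UNIV_inj_surj)
qed

lemma independent_frame:
  assumes "independent a b c" "independent i j k"
  shows "independent (frame a b c i) (frame a b c j) (frame a b c k)"
proof -
  have "frame a b c p = frame a b c q \<longleftrightarrow> p = q" for p q
    using bij_frame[OF assms(1)] by (simp add: bij_def inj_eq)
  then show ?thesis
    using assms(2) frame_third[OF assms(1), of i j, symmetric] by (simp add: independent_iff)
qed

section \<open>Passage between points and the indices 1 to 7\<close>

fun num :: "point \<Rightarrow> nat" where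
  "num P1 = 1"
| "num P2 = 2"
| "num P3 = 3"
| "num P4 = 4"
| "num P5 = 5"
| "num P6 = 6"
| "num P7 = 7"

lemma num_eq_iff [simp]: "num i = num j \<longleftrightarrow> i = j"
  by (cases i; cases j; simp)

lemma range_num: "range num = idx"
proof -
  have "range num = num ` set points"
    by (simp add: set_points)
  then show ?thesis
    by (simp add: points_def idx_eq)
qed

lemma num_in_idx [simp]: "num i \<in> idx"
  using range_num by blast

lemma idx_cases:
  assumes "k \<in> idx"
  obtains i where "k = num i"
  using assms range_num by blast

lemma star_num: "i \<noteq> j \<Longrightarrow> num i \<ast> num j = num (third i j)"
  by (rule starI, simp, cases i; cases j; simp add: gvec_def)

lemma generative_num: "generative (num i) (num j) (num k) \<longleftrightarrow> independent i j k"
  by (auto simp: generative_def independent_iff star_num)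

section \<open>Edge sets as lists of pairs\<close>

fun edge :: "pair \<Rightarrow> nat set" where
  "edge (i, j) = {num i, num j}"

definition edge_set :: "pair list \<Rightarrow> nat set set" where
  "edge_set xs = edge ` set xs"

text \<open>Equality of unordered pairs. If \<open>p = i\<close>, the sets agree exactly when
  \<open>q = j\<close>, even for degenerate pairs, so the swapped case has to be tried only when
  \<open>p\<close> differs from \<open>i\<close>.\<close>

fun same_pair :: "pair \<Rightarrow> pair \<Rightarrow> bool" where
  "same_pair (i, j) (p, q) =
    (if p = i then q = j else if p = j then q = i else False)"

definition has :: "pair list \<Rightarrow> pair \<Rightarrow> bool" where
  "has xs e = lazy_ex (same_pair e) xs"

lemma edge_eq_iff: "edge e = edge f \<longleftrightarrow> same_pair e f"
  by (cases e; cases f) (auto simp: doubleton_eq_iff)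

lemma edge_set_iff_has: "edge e \<in> edge_set xs \<longleftrightarrow> has xs e"
  by (auto simp: edge_set_def has_def lazy_ex_iff edge_eq_iff image_iff)

lemma edge_in_edges: "edge (i, j) \<in> edges \<longleftrightarrow> i \<noteq> j"
proof
  show "edge (i, j) \<in> edges \<Longrightarrow> i \<noteq> j"
    by (auto simp: edges_def doubleton_eq_iff)
  show "i \<noteq> j \<Longrightarrow> edge (i, j) \<in> edges"
    unfolding edges_def using num_in_idx num_eq_iff by fastforce
qed

lemma edges_eq: "edges = edge_set pairs"
proof -
  have "i \<noteq> j \<Longrightarrow> edge (i, j) \<in> edge_set pairs" for i j
    unfolding edge_set_iff_has
    by (cases i; cases j; simp add: has_def pairs_def)
  moreover have "edge_set pairs \<subseteq> edges"
    by (auto simp: edge_set_def pairs_def edge_in_edges simp del: edge.simps)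
  ultimately show ?thesis
    by (auto simp: edges_def elim!: idx_cases)
qed

definition pasch :: "point \<Rightarrow> point \<Rightarrow> point \<Rightarrow> pair list" where
  "pasch i j k =
    [(i, j), (j, k), (k, i), (i, third j k), (j, third k i), (k, third i j)]"

lemma P_num:
  assumes "independent i j k"
  shows "P (num i) (num j) (num k) = edge_set (pasch i j k)"
proof -
  have "i \<noteq> j" "j \<noteq> k" "k \<noteq> i"
    using assms by (auto simp: independent_iff)
  then show ?thesis
    by (simp add: P_def pasch_def edge_set_def star_num)
qed

text \<open>Rotating the triple turns the single condition that \<open>k\<close> is not
  \<open>third i j\<close> into the conditions that make the last three pairs nondegenerate.\<close>

lemma pasch_subset_edges:
  assumes "independent i j k"
  shows "edge_set (pasch i j k) \<subseteq> edges"
  using assms independent_rotate[OF assms] independent_rotate[OF independent_rotate[OF assms]]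
  by (auto simp: pasch_def edge_set_def edge_in_edges independent_iff simp del: edge.simps)

text \<open>Indices start at 0, so entry \<open>n\<close> encodes \<open>Trep (Suc n)\<close>. The
  order matters: adding an edge and drawing the forced consequences always leads to a copy of a
  later entry.\<close>

definition reps :: "pair list list" where
  "reps =
    [[],
     [(P1,P2)],
     [(P1,P2), (P1,P3)],
     [(P1,P2), (P1,P5)],
     [(P1,P2), (P6,P7)],
     [(P1,P2), (P1,P5), (P2,P5)],
     [(P2,P5), (P3,P6), (P4,P7)],
     [(P1,P2), (P1,P3), (P1,P4)],
     [(P1,P2), (P1,P3), (P1,P5)],
     [(P1,P2), (P1,P3), (P1,P7)],
     [(P1,P2), (P1,P6), (P2,P6)],
     [(P1,P2), (P1,P6), (P6,P7)],
     [(P1,P2), (P1,P3), (P1,P4), (P1,P5)],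
     [(P1,P2), (P1,P3), (P1,P5), (P1,P6)],
     [(P1,P2), (P1,P6), (P1,P7), (P2,P6)],
     [(P1,P2), (P1,P6), (P2,P7), (P6,P7)],
     [(P1,P2), (P1,P3), (P1,P4), (P1,P5), (P1,P6)],
     [(P1,P2), (P1,P6), (P1,P7), (P2,P6), (P2,P7)],
     [(P3,P4), (P3,P6), (P3,P7), (P4,P6), (P4,P7), (P6,P7)],
     [(P1,P2), (P1,P3), (P1,P4), (P1,P5), (P1,P6), (P1,P7)],
     [(P1,P2), (P1,P3), (P1,P7), (P2,P3), (P2,P6), (P3,P5)],
     [(P1,P2), (P1,P3), (P1,P4), (P1,P5), (P1,P6), (P1,P7), (P2,P3), (P2,P6), (P3,P5), (P5,P6)],
     [(P1,P2), (P1,P3), (P1,P4), (P1,P5), (P1,P6), (P1,P7), (P2,P3),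
      (P2,P4), (P2,P5), (P2,P6), (P2,P7), (P3,P5), (P4,P5), (P5,P6),
      (P5,P7)],
     pairs]"

lemma length_reps: "length reps = 24"
  by (simp add: reps_def)

lemma T22_eq: "P 1 2 3 \<union> P 1 2 6 \<union> P 1 3 5 \<union> P 1 5 6 = edge_set (reps ! 21)"
proof -
  have "independent P1 P2 P3" "independent P1 P2 P6" "independent P1 P3 P5" "independent P1 P5 P6"
    by (simp_all add: independent_def)
  note this[THEN P_num]
  then show ?thesis
    by (simp add: pasch_def edge_set_def reps_def) (auto simp: insert_commute)
qed

lemma T23_eq: "edges - T19 = edge_set (reps ! 22)"
  by (simp add: edges_eq edge_set_def pairs_def T19_def reps_def insert_Diff_if doubleton_eq_iff)

lemma T20_eq: "{{1, j} | j. 2 \<le> j \<and> j \<le> 7} = edge_set (reps ! 19)"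
proof -
  have "{{1, j} | j. 2 \<le> j \<and> j \<le> 7} = (\<lambda>j. {1, j}) ` {2..7::nat}"
    by auto
  also have "{2..7} = {2, 3, 4, 5, 6, 7::nat}"
    by auto
  finally show ?thesis
    by (simp add: edge_set_def reps_def)
qed

lemma Trep_eq:
  assumes "n < 24"
  shows "Trep (Suc n) = edge_set (reps ! n)"
proof -
  have "Trep (Suc n) = map edge_set reps ! n"
    \<comment> \<open>\<open>P_123\<close> has to wait for a second pass: it would otherwise rewrite
      the \<open>P 1 2 3\<close> inside the union to which \<open>T22_eq\<close> applies.\<close>
    unfolding Trep_def T20_eq T22_eq T23_eq unfolding P_123
    by (simp add: edges_eq reps_def T19_def edge_set_def)
  then show ?thesis
    using assms by (simp add: length_reps)
qed

lemma reps_subset_edges: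
  assumes "n < 24"
  shows "edge_set (reps ! n) \<subseteq> edges"
proof -
  have "lazy_all (\<lambda>xs. set xs \<subseteq> set pairs) reps"
    by (simp add: reps_def) (simp add: pairs_def)
  then show ?thesis
    using assms by (force simp: lazy_all_iff edges_eq edge_set_def length_reps)
qed

lemma distinct_edges: "distinct (map edge pairs)"
  by (simp add: pairs_def doubleton_eq_iff)

lemma card_edge_set:
  assumes "n < 24"
  shows "card (edge_set (reps ! n)) = length (reps ! n)"
proof -
  have "list_all (\<lambda>xs. distinct (map edge xs)) reps"
    using distinct_edges by (simp add: reps_def doubleton_eq_iff)
  then have "distinct (map edge (reps ! n))"
    using assms by (simp add: list_all_length length_reps)
  then show ?thesis
    unfolding edge_set_def set_map[symmetric] by (metis distinct_card length_map)
qed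

text \<open>Reads the position of a representative off its cardinality. Positions start at 0, one
  below the subscripts of \<open>Trep\<close>.\<close>

lemma length_reps_cases:
  assumes "n < 24" and "k = length (reps ! n)"
  shows "(k = 1 \<longrightarrow> n = 1) \<and> (k = 2 \<longrightarrow> n \<in> {2..4}) \<and> (k = 3 \<longrightarrow> n \<in> {5..11}) \<and>
    (k = 4 \<longrightarrow> n \<in> {12..15}) \<and> (k = 5 \<longrightarrow> n \<in> {16..17}) \<and> (k = 6 \<longrightarrow> n \<in> {18..20}) \<and>
    (k = 10 \<longrightarrow> n = 21) \<and> (k = 15 \<longrightarrow> n = 22) \<and> (k = 21 \<longrightarrow> n = 23) \<and>
    k \<in> {0, 1, 2, 3, 4, 5, 6, 10, 15, 21}" (is "?Q n k")
proof -
  let ?ks = "[0, 1, 2, 2, 2, 3, 3, 3, 3, 3, 3, 3, 4, 4, 4, 4, 5, 5, 6, 6, 6, 10, 15, 21]"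
  have "map length reps = ?ks"
    by (simp add: reps_def pairs_def)
  then have "k = ?ks ! n"
    using assms by (metis length_reps nth_map)
  moreover have "\<forall>n\<in>set [0..<24]. ?Q n (?ks ! n)"
    by code_simp
  ultimately show ?thesis
    using assms(1) by simp
qed

section \<open>Collineations\<close>

lemma star_in_idx: "i \<in> idx \<Longrightarrow> j \<in> idx \<Longrightarrow> i \<noteq> j \<Longrightarrow> i \<ast> j \<in> idx"
  by (auto elim!: idx_cases simp: star_num)

lemma collineation_id: "collineation id"
  by (simp add: collineation_def)

lemma collineation_in_idx: "collineation \<sigma> \<Longrightarrow> i \<in> idx \<Longrightarrow> \<sigma> i \<in> idx"
  by (auto simp: collineation_def bij_betw_def)

lemma collineation_neq:
  "collineation \<sigma> \<Longrightarrow> i \<in> idx \<Longrightarrow> j \<in> idx \<Longrightarrow> i \<noteq> j \<Longrightarrow> \<sigma> i \<noteq> \<sigma> j"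
  by (auto simp: collineation_def bij_betw_def inj_on_def)

lemma collineation_star:
  "collineation \<sigma> \<Longrightarrow> i \<in> idx \<Longrightarrow> j \<in> idx \<Longrightarrow> i \<noteq> j \<Longrightarrow> \<sigma> (i \<ast> j) = \<sigma> i \<ast> \<sigma> j"
  by (simp add: collineation_def)

lemma collineation_comp:
  assumes "collineation \<sigma>" "collineation \<tau>"
  shows "collineation (\<sigma> \<circ> \<tau>)"
proof -
  have "bij_betw (\<sigma> \<circ> \<tau>) idx idx"
    using assms bij_betw_trans[of \<tau> idx idx \<sigma> idx] by (simp add: collineation_def)
  moreover have "\<sigma> (\<tau> (i \<ast> j)) = \<sigma> (\<tau> i) \<ast> \<sigma> (\<tau> j)"
    if "i \<in> idx" "j \<in> idx" "i \<noteq> j" for i j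
    using assms that
    by (simp add: collineation_star collineation_in_idx collineation_neq)
  ultimately show ?thesis
    by (simp add: collineation_def)
qed

lemma collineation_inv:
  assumes "collineation \<sigma>"
  shows "collineation (inv_into idx \<sigma>)"
proof -
  let ?\<tau> = "inv_into idx \<sigma>"
  have bij: "bij_betw \<sigma> idx idx"
    using assms by (simp add: collineation_def)
  have \<tau>: "bij_betw ?\<tau> idx idx"
    using bij by (rule bij_betw_inv_into)
  have "?\<tau> (i \<ast> j) = ?\<tau> i \<ast> ?\<tau> j" if "i \<in> idx" "j \<in> idx" "i \<noteq> j" for i j
  proof -
    have ij: "?\<tau> i \<in> idx" "?\<tau> j \<in> idx" "?\<tau> i \<noteq> ?\<tau> j"
      using \<tau> that by (auto simp: bij_betw_def inj_on_def)
    then have "\<sigma> (?\<tau> i \<ast> ?\<tau> j) = i \<ast> j"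
      using assms that bij by (simp add: collineation_def bij_betw_inv_into_right)
    then show ?thesis
      using bij_betw_inv_into_left[OF bij star_in_idx[OF ij]] by simp
  qed
  with \<tau> show ?thesis
    by (simp add: collineation_def)
qed

text \<open>A collineation is constrained on \<open>idx\<close> only, so injectivity on sets is
  available only for subsets of \<open>idx\<close>, among them the edges.\<close>

lemma inj_on_image_edges:
  assumes "collineation \<sigma>"
  shows "inj_on (\<lambda>e. \<sigma> ` e) edges"
proof (rule inj_onI)
  have inj: "inj_on \<sigma> idx"
    using assms by (simp add: collineation_def bij_betw_def)
  fix e f assume "e \<in> edges" "f \<in> edges" "\<sigma> ` e = \<sigma> ` f"
  moreover from this have "e \<subseteq> idx" "f \<subseteq> idx"
    by (auto simp: edges_def)
  ultimately show "e = f"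
    using inj by (simp add: inj_on_image_eq_iff)
qed

text \<open>An injective map of a finite set into itself is onto.\<close>

lemma collineation_edges:
  assumes "collineation \<sigma>"
  shows "(\<lambda>e. \<sigma> ` e) ` edges = edges"
proof (rule card_subset_eq)
  show fin: "finite edges"
    by (simp add: edges_eq edge_set_def)
  show "(\<lambda>e. \<sigma> ` e) ` edges \<subseteq> edges"
  proof
    fix e assume "e \<in> (\<lambda>e. \<sigma> ` e) ` edges"
    then obtain i j where "e = {\<sigma> i, \<sigma> j}" "i \<in> idx" "j \<in> idx" "i \<noteq> j"
      by (auto simp: edges_def)
    then show "e \<in> edges"
      using collineation_in_idx[OF assms] collineation_neq[OF assms]
      unfolding edges_def by blast
  qed
  show "card ((\<lambda>e. \<sigma> ` e) ` edges) = card edges"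
    by (rule card_image[OF inj_on_image_edges[OF assms]])
qed

text \<open>The inverse collineation undoes \<sigma> on subsets of \<open>idx\<close>, hence on
  every edge of \<open>T\<close>.\<close>

lemma collinear_sets_sym:
  assumes "collinear_sets T T'" "T \<subseteq> edges"
  shows "collinear_sets T' T"
proof -
  obtain \<sigma> where \<sigma>: "collineation \<sigma>" "T' = (\<lambda>e. \<sigma> ` e) ` T"
    using assms(1) by (auto simp: collinear_sets_def)
  have "inj_on \<sigma> idx"
    using \<sigma>(1) by (simp add: collineation_def bij_betw_def)
  then have "inv_into idx \<sigma> ` \<sigma> ` e = e" if "e \<in> T" for e
    using assms(2) that by (auto simp: edges_def)
  then have "(\<lambda>e. inv_into idx \<sigma> ` e) ` T' = T"
    by (simp add: \<sigma>(2) image_image)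
  then show ?thesis
    using collineation_inv[OF \<sigma>(1)] by (auto simp: collinear_sets_def)
qed

lemma collinear_sets_trans:
  assumes "collinear_sets T T'" "collinear_sets T' T''"
  shows "collinear_sets T T''"
proof -
  obtain \<sigma> \<tau> where \<sigma>: "collineation \<sigma>" "(\<lambda>e. \<sigma> ` e) ` T = T'"
    and \<tau>: "collineation \<tau>" "(\<lambda>e. \<tau> ` e) ` T' = T''"
    using assms by (auto simp: collinear_sets_def)
  have "(\<lambda>e. (\<tau> \<circ> \<sigma>) ` e) ` T = T''"
    by (simp add: \<sigma>(2)[symmetric] \<tau>(2)[symmetric] image_image image_comp)
  then show ?thesis
    using collineation_comp[OF \<tau>(1) \<sigma>(1)] by (auto simp: collinear_sets_def)
qed

lemma collinear_sets_card:
  assumes "collinear_sets T T'" "T \<subseteq> edges"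
  shows "card T' = card T"
  using assms inj_on_subset[OF inj_on_image_edges]
  by (auto simp: collinear_sets_def intro!: card_image)

text \<open>A linear map is determined by its values on a basis: the remaining four points arise
  from \<open>P1\<close>, \<open>P2\<close>, \<open>P3\<close> by \<open>third\<close>, which a
  collineation preserves.\<close>

lemma collineation_frame:
  assumes "collineation \<sigma>"
  obtains a b c where "independent a b c" "\<And>i. \<sigma> (num i) = num (frame a b c i)"
proof -
  have bij: "bij_betw \<sigma> idx idx"
    and hom: "\<And>i j. i \<noteq> j \<Longrightarrow> \<sigma> (num (third i j)) = \<sigma> (num i) \<ast> \<sigma> (num j)"
    using assms by (auto simp: collineation_def star_num[symmetric])
  define f where "f i = inv num (\<sigma> (num i))" for i
  have f: "\<sigma> (num i) = num (f i)" for i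
    using bij_betwE[OF bij] num_in_idx by (simp add: f_def f_inv_into_f range_num)
  have inj: "f i \<noteq> f j" if "i \<noteq> j" for i j
    using inj_onD[OF bij_betw_imp_inj_on[OF bij], of "num i" "num j"] that by (auto simp: f)
  have third: "f (third i j) = third (f i) (f j)" if "i \<noteq> j" for i j
    using hom[OF that] inj[OF that] by (simp add: f star_num)
  have f567: "f P5 = third (f P1) (f P2)" "f P6 = third (f P1) (f P3)"
    "f P7 = third (f P2) (f P3)" "f P4 = third (f P5) (f P3)"
    using third[of P1 P2] third[of P1 P3] third[of P2 P3] third[of P5 P3] by simp_all
  \<comment> \<open>\<open>P5\<close> is the third point on the line through \<open>P1\<close> and
    \<open>P2\<close>. As \<open>P3\<close> differs from it, injectivity keeps \<open>f P3\<close>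
    off the image line.\<close>
  have "independent (f P1) (f P2) (f P3)"
    using inj[of P3 P5] by (simp add: independent_iff inj f567)
  moreover have "\<sigma> (num i) = num (frame (f P1) (f P2) (f P3) i)" for i
    unfolding f by (cases i) (simp_all add: frame_def f567)
  ultimately show thesis
    by (rule that)
qed

lemma frame_collineation:
  assumes "independent a b c"
  obtains \<sigma> where "collineation \<sigma>" "\<And>i. \<sigma> (num i) = num (frame a b c i)"
proof -
  \<comment> \<open>Outside \<open>idx\<close> the value of \<open>inv num\<close> is arbitrary,
    which \<open>collineation\<close> permits.\<close>
  define \<sigma> where "\<sigma> = num \<circ> frame a b c \<circ> inv num"
  have \<sigma>: "\<sigma> (num i) = num (frame a b c i)" for i
    by (simp add: \<sigma>_def inj_def)
  have inj: "inj (frame a b c)" and surj: "surj (frame a b c)"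
    using bij_frame[OF assms] by (simp_all add: bij_def)
  have "bij_betw \<sigma> idx idx"
    unfolding range_num[symmetric] bij_betw_def inj_on_def image_image \<sigma>
  proof
    show "\<forall>x\<in>range num. \<forall>y\<in>range num. \<sigma> x = \<sigma> y \<longrightarrow> x = y"
      using inj by (auto simp: \<sigma> dest: injD)
    show "range (\<lambda>x. num (frame a b c x)) = range num"
      using surj by (metis image_image)
  qed
  moreover have "\<sigma> (i \<ast> j) = \<sigma> i \<ast> \<sigma> j" if ij: "i \<in> idx" "j \<in> idx" "i \<noteq> j" for i j
  proof -
    obtain p q where pq: "i = num p" "j = num q" "p \<noteq> q"
      using ij by (metis idx_cases)
    moreover have "frame a b c p \<noteq> frame a b c q"
      using inj pq(3) by (simp add: inj_eq)
    ultimately show ?thesis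
      using frame_third[OF assms pq(3)] by (simp add: \<sigma> star_num)
  qed
  ultimately have "collineation \<sigma>"
    unfolding collineation_def by blast
  then show thesis
    using \<sigma> by (rule that)
qed

section \<open>Deciding by search over frames whether one edge set contains a copy of
  another\<close>

definition frame_maps :: "pair list \<Rightarrow> pair list \<Rightarrow> point \<Rightarrow> point \<Rightarrow> point \<Rightarrow> bool" where
  "frame_maps xs ys a b c =
    (if independent a b c
     then lazy_all (has ys \<circ> map_prod (frame a b c) (frame a b c)) xs
     else False)"

definition frame_maps2 :: "pair list \<Rightarrow> pair list \<Rightarrow> point \<Rightarrow> point \<Rightarrow> bool" where
  "frame_maps2 xs ys a b = lazy_ex (frame_maps xs ys a b) points"

definition frame_maps1 :: "pair list \<Rightarrow> pair list \<Rightarrow> point \<Rightarrow> bool" where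
  "frame_maps1 xs ys a = lazy_ex (frame_maps2 xs ys a) points"

text \<open>The host comes first and the pattern second, so that a fixed host can be tested against
  a list of patterns.\<close>

definition has_copy :: "pair list \<Rightarrow> pair list \<Rightarrow> bool" where
  "has_copy ys xs = lazy_ex (frame_maps1 xs ys) points"

text \<open>Every collineation agrees on \<open>idx\<close> with a frame, and every frame on an
  independent triple extends to a collineation. A finite search therefore decides an existential
  over functions on the naturals.\<close>

lemma has_copy_iff:
  "has_copy ys xs \<longleftrightarrow>
    (\<exists>\<sigma>. collineation \<sigma> \<and> (\<lambda>e. \<sigma> ` e) ` edge_set xs \<subseteq> edge_set ys)"
proof -
  have image: "(\<lambda>e. \<sigma> ` e) ` edge_set xs \<subseteq> edge_set ys \<longleftrightarrow>
      lazy_all (has ys \<circ> map_prod f f) xs" if "\<And>i. \<sigma> (num i) = num (f i)" for \<sigma> f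
  proof -
    have "\<sigma> ` edge e = edge (map_prod f f e)" for e
      by (cases e) (simp add: that)
    then show ?thesis
      by (simp add: edge_set_def[of xs] image_subset_iff lazy_all_iff edge_set_iff_has)
  qed
  have "has_copy ys xs \<longleftrightarrow>
      (\<exists>a b c. independent a b c \<and> lazy_all (has ys \<circ> map_prod (frame a b c) (frame a b c)) xs)"
    by (auto simp: has_copy_def frame_maps1_def frame_maps2_def frame_maps_def lazy_ex_iff set_points)
  also have "\<dots> \<longleftrightarrow> (\<exists>\<sigma>. collineation \<sigma> \<and> (\<lambda>e. \<sigma> ` e) ` edge_set xs \<subseteq> edge_set ys)"
    (is "?L \<longleftrightarrow> ?R")
  proof
    assume ?L
    then show ?R
      using frame_collineation image by metis
  next
    assume ?R
    then show ?L
      using collineation_frame image by metis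
  qed
  finally show ?thesis .
qed

section \<open>Nice sets\<close>

lemma nice_pasch:
  assumes "nice T" "independent i j k" "edge (i, j) \<in> T" "edge (third i j, k) \<in> T"
  shows "edge_set (pasch i j k) \<subseteq> T"
proof -
  have "i \<noteq> j"
    using assms(2) by (simp add: independent_iff)
  then have "{num i \<ast> num j, num k} \<in> T"
    using assms(4) by (simp add: star_num)
  then show ?thesis
    using assms unfolding nice_def P_num[OF assms(2), symmetric] by (simp add: generative_num)
qed

text \<open>Serves to move a copy inside a nice set back to the representative itself. Premises are
  carried forward by \<sigma> and the conclusion is pulled back, so no inverse map is
  involved.\<close>

lemma nice_preimage:
  assumes "nice T" "collineation \<sigma>"
  shows "nice {e \<in> edges. \<sigma> ` e \<in> T}"
proof -
  obtain a b c where abc: "independent a b c" and "\<And>i. \<sigma> (num i) = num (frame a b c i)"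
    using collineation_frame[OF assms(2)] by blast
  then have image: "\<sigma> ` edge (i, j) = edge (frame a b c i, frame a b c j)" for i j
    by simp
  have pasch: "P (num i) (num j) (num k) \<subseteq> {e \<in> edges. \<sigma> ` e \<in> T}"
    if ind: "independent i j k" and "\<sigma> ` edge (i, j) \<in> T" "\<sigma> ` edge (third i j, k) \<in> T" for i j k
  proof -
    let ?f = "frame a b c"
    have f: "?f (third p q) = third (?f p) (?f q)" if "p \<noteq> q" for p q
      using frame_third[OF abc that] .
    have neq: "i \<noteq> j" "j \<noteq> k" "k \<noteq> i"
      using ind by (auto simp: independent_iff)
    \<comment> \<open>The image triple is again independent and satisfies the premises of niceness
      in \<open>T\<close>; its six edges are the images of the six edges required.\<close>
    have "edge_set (pasch (?f i) (?f j) (?f k)) \<subseteq> T"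
      using that neq by (intro nice_pasch[OF assms(1) independent_frame[OF abc]])
        (simp_all add: image f del: edge.simps)
    then have "\<sigma> ` e \<in> T" if "e \<in> edge_set (pasch i j k)" for e
      using that neq by (auto simp: pasch_def edge_set_def image f simp del: edge.simps)
    then show ?thesis
      using pasch_subset_edges[OF ind] by (auto simp: P_num[OF ind])
  qed
  have "P i j k \<subseteq> {e \<in> edges. \<sigma> ` e \<in> T}"
    if gen: "generative i j k" and ij: "\<sigma> ` {i, j} \<in> T" and ijk: "\<sigma> ` {i \<ast> j, k} \<in> T" for i j k
  proof -
    have "i \<in> idx" "j \<in> idx" "k \<in> idx"
      using gen by (simp_all add: generative_def)
    then obtain p q r where pqr: "i = num p" "j = num q" "k = num r"
      by (metis idx_cases)
    have ind: "independent p q r"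
      using gen by (simp add: pqr generative_num)
    then have "i \<ast> j = num (third p q)"
      by (simp add: pqr star_num independent_iff)
    then show ?thesis
      using pasch[OF ind] ij ijk by (simp add: pqr)
  qed
  then show ?thesis
    unfolding nice_def by blast
qed

fun derived :: "pair \<Rightarrow> pair \<Rightarrow> pair list" where
  "derived (i, j) (p, q) =
    (if third i j = p \<and> independent i j q then pasch i j q
     else if third i j = q \<and> independent i j p then pasch i j p
     else [])"

text \<open>One use of niceness, with \<open>e\<close> as {i, j} and \<open>f\<close> as {i * j, k}.
  The two branches of \<open>derived\<close> allow for either orientation of
  \<open>f\<close>.\<close>

lemma derived_subset:
  assumes "nice T" "edge e \<in> T" "edge f \<in> T"
  shows "edge_set (derived e f) \<subseteq> T"
proof -
  obtain i j p q where "e = (i, j)" "f = (p, q)"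
    by fastforce
  then show ?thesis
    using assms nice_pasch[OF assms(1), of i j p] nice_pasch[OF assms(1), of i j q]
    by (auto simp: edge_set_def insert_commute)
qed

text \<open>
  A fragment of the closure of \<open>xs\<close> with \<open>e\<close> added: since the representatives are nice already, only
  inferences with \<open>e\<close> among the premises are drawn, and one round of them turns out to suffice.
\<close>

definition saturate :: "pair \<Rightarrow> pair list \<Rightarrow> pair list" where
  "saturate e xs = e # xs @ concat (map (\<lambda>f. derived e f @ derived f e) xs)"

lemma saturate_subset:
  assumes "nice T" "edge_set (e # xs) \<subseteq> T"
  shows "edge_set (saturate e xs) \<subseteq> T"
proof -
  have "edge e \<in> T" "\<And>f. f \<in> set xs \<Longrightarrow> edge f \<in> T"
    using assms(2) by (auto simp: edge_set_def)
  then have "edge_set (derived e f) \<subseteq> T" "edge_set (derived f e) \<subseteq> T" if "f \<in> set xs" for f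
    using derived_subset[OF assms(1)] that by blast+
  moreover have "edge_set (saturate e xs) =
      edge_set (e # xs) \<union> (\<Union>f\<in>set xs. edge_set (derived e f) \<union> edge_set (derived f e))"
    by (auto simp: saturate_def edge_set_def simp del: edge.simps)
  ultimately show ?thesis
    using assms(2) by blast
qed

definition extends :: "pair list \<Rightarrow> pair list list \<Rightarrow> pair \<Rightarrow> bool" where
  "extends xs xss e = (if has xs e then True else lazy_ex (has_copy (saturate e xs)) xss)"

fun climbs :: "pair list list \<Rightarrow> bool" where
  "climbs [] = True"
| "climbs (xs # xss) = (if lazy_all (extends xs xss) pairs then climbs xss else False)"

text \<open>The tail searched for entry \<open>n\<close> consists of the entries at positions beyond
  \<open>n\<close>, which is where the inequality \<open>n < m\<close> comes from.\<close>

lemma climbs_nth: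
  assumes "climbs xss" "n < length xss" "e \<in> set pairs" "\<not> has (xss ! n) e"
  shows "\<exists>m. n < m \<and> m < length xss \<and> has_copy (saturate e (xss ! n)) (xss ! m)"
  using assms(1,2,4)
proof (induction xss arbitrary: n)
  case (Cons xs xss)
  then have extends: "extends xs xss e" and climbs: "climbs xss"
    using assms(3) by (auto simp: lazy_all_iff split: if_splits)
  show ?case
  proof (cases n)
    case 0
    then have "\<exists>ys\<in>set xss. has_copy (saturate e xs) ys"
      using extends Cons.prems(3) by (simp add: extends_def lazy_ex_iff)
    then obtain m where "m < length xss" "has_copy (saturate e xs) (xss ! m)"
      by (auto simp: in_set_conv_nth)
    with 0 show ?thesis
      by (intro exI[of _ "Suc m"]) simp
  next
    case (Suc k)
    then obtain m where "k < m" "m < length xss" "has_copy (saturate e (xss ! k)) (xss ! m)"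
      using Cons.IH[OF climbs, of k] Cons.prems by auto
    with Suc show ?thesis
      by (intro exI[of _ "Suc m"]) simp
  qed
qed simp

text \<open>The computation behind existence: it settles all 386 cases of a representative and an
  edge outside it.\<close>

lemma reps_climb: "climbs reps"
  by code_simp

lemma reps_extend:
  assumes "n < 24" "nice T" "edge_set (reps ! n) \<subset> T"
  obtains m \<sigma> where "n < m" "m < 24" "collineation \<sigma>" "(\<lambda>e. \<sigma> ` e) ` edge_set (reps ! m) \<subseteq> T"
proof -
  obtain x where "x \<in> T" "x \<notin> edge_set (reps ! n)"
    using assms(3) by blast
  moreover have "T \<subseteq> edge_set pairs"
    using assms(2) by (simp add: nice_def edges_eq)
  ultimately obtain e where e: "e \<in> set pairs" "edge e \<in> T" "\<not> has (reps ! n) e"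
    by (auto simp: edge_set_def edge_set_iff_has[symmetric])
  then obtain m where m: "n < m" "m < 24" "has_copy (saturate e (reps ! n)) (reps ! m)"
    using climbs_nth[OF reps_climb, of n e] assms(1) by (auto simp: length_reps)
  moreover have "edge_set (saturate e (reps ! n)) \<subseteq> T"
    using assms e by (intro saturate_subset) (auto simp: edge_set_def)
  ultimately show thesis
    using that unfolding has_copy_iff by (meson subset_trans)
qed

lemma nice_collinear:
  assumes "nice T"
  obtains n where "n < 24" "collinear_sets T (Trep (Suc n))"
proof -
  define embeds where "embeds n \<longleftrightarrow>
    n < 24 \<and> (\<exists>\<sigma>. collineation \<sigma> \<and> (\<lambda>e. \<sigma> ` e) ` edge_set (reps ! n) \<subseteq> T)" for n
  \<comment> \<open>The empty set lies in every \<open>T\<close>, and indices are bounded, so a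
    largest embedded index exists.\<close>
  have "embeds 0"
    using collineation_id by (auto simp: embeds_def reps_def edge_set_def)
  moreover have "\<forall>n. embeds n \<longrightarrow> n \<le> 24"
    by (simp add: embeds_def)
  ultimately obtain n where n: "embeds n" "\<And>m. embeds m \<Longrightarrow> m \<le> n"
    using GreatestI_nat Greatest_le_nat by metis
  then obtain \<sigma> where "n < 24" and \<sigma>: "collineation \<sigma>"
    and sub: "(\<lambda>e. \<sigma> ` e) ` edge_set (reps ! n) \<subseteq> T"
    by (auto simp: embeds_def)
  \<comment> \<open>In this preimage the copy of the representative becomes the representative
    itself, as \<open>reps_extend\<close> requires.\<close>
  define T' where "T' = {e \<in> edges. \<sigma> ` e \<in> T}"
  have "nice T'"
    unfolding T'_def using assms \<sigma> by (rule nice_preimage)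
  \<comment> \<open>Since \<sigma> permutes the edges, no edge of \<open>T\<close> is lost by
    passing to the preimage.\<close>
  have "T \<subseteq> (\<lambda>e. \<sigma> ` e) ` edges"
    using assms by (simp add: nice_def collineation_edges[OF \<sigma>])
  then have T: "T = (\<lambda>e. \<sigma> ` e) ` T'"
    by (auto simp: T'_def)
  have edges_n: "edge_set (reps ! n) \<subseteq> edges"
    using reps_subset_edges[OF \<open>n < 24\<close>] .
  then have sub': "edge_set (reps ! n) \<subseteq> T'"
    using sub by (auto simp: T'_def)
  have "edge_set (reps ! n) = T'"
  proof (rule ccontr)
    assume "edge_set (reps ! n) \<noteq> T'"
    with sub' obtain m \<tau> where m: "n < m" "m < 24" and \<tau>: "collineation \<tau>"
      and "(\<lambda>e. \<tau> ` e) ` edge_set (reps ! m) \<subseteq> T'"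
      using reps_extend[OF \<open>n < 24\<close> \<open>nice T'\<close>] by (metis psubsetI)
    then have "(\<lambda>e. \<sigma> ` e) ` (\<lambda>e. \<tau> ` e) ` edge_set (reps ! m) \<subseteq> T"
      unfolding T by (simp only: image_mono)
    then have "(\<lambda>e. (\<sigma> \<circ> \<tau>) ` e) ` edge_set (reps ! m) \<subseteq> T"
      by (simp add: image_image image_comp)
    then have "embeds m"
      using collineation_comp[OF \<sigma> \<tau>] m unfolding embeds_def by blast
    then show False
      using n(2) m(1) by fastforce
  qed
  then have "collinear_sets (edge_set (reps ! n)) T"
    using T \<sigma> by (auto simp: collinear_sets_def)
  then show thesis
    using that \<open>n < 24\<close> collinear_sets_sym edges_n by (simp add: Trep_eq)
qed

section \<open>Distinct representatives are not collinear\<close>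

definition apart :: "pair list \<Rightarrow> pair list \<Rightarrow> bool" where
  "apart xs ys = (if length xs = length ys then \<not> has_copy ys xs else True)"

text \<open>Only representatives of equal length are searched, as collinear sets have equal
  cardinality. Each pair is tested in one direction, the relation being symmetric on sets of
  edges.\<close>

lemma reps_apart: "sorted_wrt apart reps"
  by code_simp

lemma reps_not_collinear:
  assumes "m < n" "n < 24"
  shows "\<not> collinear_sets (edge_set (reps ! m)) (edge_set (reps ! n))"
proof
  assume collinear: "collinear_sets (edge_set (reps ! m)) (edge_set (reps ! n))"
  then have "length (reps ! n) = length (reps ! m)"
    using collinear_sets_card[OF collinear reps_subset_edges] assms by (simp add: card_edge_set)
  moreover have "apart (reps ! m) (reps ! n)"
    using reps_apart assms by (simp add: sorted_wrt_iff_nth_less length_reps)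
  ultimately have "\<not> has_copy (reps ! n) (reps ! m)"
    by (simp add: apart_def)
  then show False
    using collinear by (auto simp: has_copy_iff collinear_sets_def)
qed

theorem theorem3p27:
  fixes T :: "nat set set"
  assumes "nice T"
  shows "(\<exists>!n\<in>{1..24}. collinear_sets T (Trep n)) \<and>
    (card T = 0 \<longrightarrow> T = Trep 1) \<and>
    (card T = 1 \<longrightarrow> collinear_sets T (Trep 2)) \<and>
    (card T = 2 \<longrightarrow> (\<exists>!n\<in>{3..5}. collinear_sets T (Trep n))) \<and>
    (card T = 3 \<longrightarrow> (\<exists>!n\<in>{6..12}. collinear_sets T (Trep n))) \<and>
    (card T = 4 \<longrightarrow> (\<exists>!n\<in>{13..16}. collinear_sets T (Trep n))) \<and>
    (card T = 5 \<longrightarrow> (\<exists>!n\<in>{17..18}. collinear_sets T (Trep n))) \<and>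
    (card T = 6 \<longrightarrow> (\<exists>!n\<in>{19..21}. collinear_sets T (Trep n))) \<and>
    (card T = 10 \<longrightarrow> collinear_sets T (Trep 22)) \<and>
    (card T = 15 \<longrightarrow> collinear_sets T (Trep 23)) \<and>
    (card T = 21 \<longrightarrow> collinear_sets T (Trep 24)) \<and>
    card T \<in> {0, 1, 2, 3, 4, 5, 6, 10, 15, 21}"
proof -
  obtain n where n: "n < 24" and collinear: "collinear_sets T (Trep (Suc n))"
    using nice_collinear[OF assms] .
  have T: "T \<subseteq> edges"
    using assms by (simp add: nice_def)
  have unique: "m = Suc n" if "m \<in> {1..24}" "collinear_sets T (Trep m)" for m
  proof -
    have "m = Suc (m - 1)" "m - 1 < 24"
      using that(1) by auto
    then obtain k where k: "m = Suc k" "k < 24"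
      by blast
    then have kn: "collinear_sets T (edge_set (reps ! k))" "collinear_sets T (edge_set (reps ! n))"
      using that(2) n collinear by (simp_all add: Trep_eq)
    \<comment> \<open>Two representatives collinear to \<open>T\<close> are collinear to each other
      through \<open>T\<close>, in both directions; this rules out either strict order of
      \<open>k\<close> and \<open>n\<close>.\<close>
    note sym = kn[THEN collinear_sets_sym[OF _ T]]
    have "\<not> k < n" "\<not> n < k"
      using reps_not_collinear n k collinear_sets_trans[OF sym(1) kn(2)]
        collinear_sets_trans[OF sym(2) kn(1)] by blast+
    then show ?thesis
      using k by simp
  qed
  have ex1: "\<exists>!m\<in>A. collinear_sets T (Trep m)" if "Suc n \<in> A" "A \<subseteq> {1..24}" for A
    using that collinear unique by blast
  have card: "card T = length (reps ! n)"
    using collinear_sets_card[OF collinear T] n by (simp add: Trep_eq card_edge_set)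
  have empty: "T = Trep 1" if "card T = 0"
  proof -
    have "finite T"
      using T by (rule finite_subset) (simp add: edges_eq edge_set_def)
    with that show ?thesis
      by (simp add: Trep_def)
  qed
  \<comment> \<open>The interval for \<open>n\<close> is shifted down by one because the
    representative is \<open>Trep (Suc n)\<close>.\<close>
  have several: "card T = k \<longrightarrow> (\<exists>!m\<in>{a..b}. collinear_sets T (Trep m))"
    if "card T = k \<longrightarrow> n \<in> {a - 1..b - 1}" "1 \<le> a" "1 \<le> b" "b \<le> 24" for k a b
    using that n by (intro impI ex1) auto
  have single: "card T = k \<longrightarrow> collinear_sets T (Trep m)"
    if "card T = k \<longrightarrow> n = m - 1" "1 \<le> m" for k m
    using that collinear by auto
  have all: "\<exists>!m\<in>{1..24}. collinear_sets T (Trep m)"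
    using n by (intro ex1) auto
  show ?thesis
    using length_reps_cases[OF n card]
    by (intro conjI all impI[OF empty] several single) simp_all
qed

end
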